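(* Let $\phi:(-\infty,0]\to(0,\infty)$ be a bounded continuous function (so $\phi(s)>0$ for all $s\in(-\infty,0]$). For any $\alpha>0$ and $\beta>0$, there exists a finite time $T>0$ such that a solution $u(t)$ of the distributed delay differential equation $$\dot u(t)=\frac{1}{1-\int_{-\infty}^{t}\alpha e^{-\beta(t-s)}u(s)\,ds},\qquad u(s)=\phi(s)\quad (-\infty<s\le 0),$$ blows up at $t=T$ with the following rates: $$u(t)=A_3\left(\log\frac{1}{T-t}\right)^{1/2}(1+o(1))\quad\text{as } t\to T^-$$ and $$\dot u(t)=A_4\,(T-t)^{-1}\left(\log\frac{1}{T-t}\right)^{-1/2}(1+o(1))\quad\text{as } t\to T^-.$$ Here $A_3$ and $A_4$ are positive constants.
   Context: Here $\dot u=du/dt$, $t$ denotes the present time, and $\phi$ is the initial function (the prescribed history of $u$). The solution $u$ is said to blow up at the finite time $T\in(0,+\infty)$ (the blow-up time) if $\lim_{t\to T^-}u(t)=+\infty$, where $t\to T^-$ means that $t$ tends to $T$ from below.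
   Formalization: The formal theorem additionally assumes that the integral of α e^{βs} φ(s) over (-∞,0] is less than 1; otherwise the right-hand side is undefined at t=0 (value 1) or the solution decreases and cannot blow up to +∞ (value above 1). *)

theory Defs
  imports "HOL-Analysis.Analysis" "HOL-Library.Landau_Symbols"
begin

definition delay_term :: "real \<Rightarrow> real \<Rightarrow> (real \<Rightarrow> real) \<Rightarrow> real \<Rightarrow> real" where
  "delay_term \<alpha> \<beta> u t = (LBINT s:{..t}. \<alpha> * exp (- \<beta> * (t - s)) * u s)"

text \<open>
  The integrability condition and the condition that the denominator is nonzero exclude the junk
  values that the integral and the division have in HOL. The derivative at \<open>t = 0\<close> is the
  right derivative. Only the values of \<open>\<phi>\<close> on \<open>{..0}\<close> and of \<open>u\<close> on \<open>{..<T}\<close> matter.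
\<close>

definition is_solution ::
    "real \<Rightarrow> real \<Rightarrow> (real \<Rightarrow> real) \<Rightarrow> real \<Rightarrow> (real \<Rightarrow> real) \<Rightarrow> bool" where
  "is_solution \<alpha> \<beta> \<phi> T u \<longleftrightarrow>
     (\<forall>s\<le>0. u s = \<phi> s) \<and>
     (\<forall>t\<in>{0..<T}.
        set_integrable lborel {..t} (\<lambda>s. \<alpha> * exp (- \<beta> * (t - s)) * u s) \<and>
        1 - delay_term \<alpha> \<beta> u t \<noteq> 0 \<and>
        (u has_real_derivative 1 / (1 - delay_term \<alpha> \<beta> u t)) (at t within {0..<T}))"

definition blows_up_at :: "(real \<Rightarrow> real) \<Rightarrow> real \<Rightarrow> bool" where
  "blows_up_at u T \<longleftrightarrow> filterlim u at_top (at_left T)"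

end

theory Submission
  imports Defs "HOL-Real_Asymp.Real_Asymp"
begin

text \<open>
  Put \<open>y = 1 - delay_term \<alpha> \<beta> u\<close>. The equation is equivalent to the planar system \<open>u' = 1 / y\<close>,
  \<open>y' = \<beta> * (1 - y) - \<alpha> * u\<close>. Since \<open>y' / y = \<beta> * u' - \<alpha> * u * u' - \<beta>\<close>, this system has the first
  integral \<open>ln y - \<beta> * u + \<alpha> * u\<^sup>2 / 2 + \<beta> * t\<close>, so \<open>u\<close> solves the separable equation
  \<open>u' = K * exp (\<beta> * t + \<alpha> * u\<^sup>2 / 2 - \<beta> * u)\<close>. As \<open>exp (\<beta> * v - \<alpha> * v\<^sup>2 / 2)\<close> is integrable at
  \<open>+\<infinity>\<close>, the solution blows up, and l'Hopital's rule gives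
  \<open>exp (\<beta> * u - \<alpha> * u\<^sup>2 / 2) \<sim> c * u * (T - t)\<close>, from which both rates follow.
\<close>

section \<open>Solving the separable equation up to its blow-up time\<close>

text \<open>Separation of variables needs the inverse of an antiderivative. The range of
  \<open>G\<close> may be a bounded interval, so \<open>g\<close> is a right inverse only between
  two attained values, where the intermediate value theorem applies.\<close>

lemma strict_mono_antiderivative_inverse:
  fixes G h :: "real \<Rightarrow> real"
  assumes G: "\<And>x. (G has_real_derivative h x) (at x)"
    and h: "\<And>x. h x > 0"
  obtains g where "strict_mono G" "\<And>x. g (G x) = x"
    "\<And>x. (g has_real_derivative inverse (h x)) (at (G x))"
    "\<And>a b y. G a \<le> y \<Longrightarrow> y \<le> G b \<Longrightarrow> G (g y) = y"
proof -
  have mono: "strict_mono G"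
    using DERIV_pos_imp_increasing[of _ _ G] G h by (intro strict_monoI) blast
  have cont: "isCont G x" for x
    using G DERIV_isCont by blast
  define g where "g = inv G"
  have gG: "g (G x) = x" for x
    unfolding g_def using mono by (simp add: strict_mono_imp_inj_on)
  have Gg: "G (g y) = y" if y: "G a \<le> y" "y \<le> G b" for a b y
  proof -
    have "a \<le> b"
      using y mono by (meson order_trans strict_mono_less_eq)
    then obtain x where "G x = y"
      using IVT[of G a y b] y cont by blast
    then show ?thesis
      using gG by auto
  qed
  have "(g has_real_derivative inverse (h x)) (at (G x))" for x
  proof (rule DERIV_inverse_function[where f = G and a = "G (x - 1)" and b = "G (x + 1)"])
    show "(G has_real_derivative h x) (at (g (G x)))"
      using G gG by simp
    show "h x \<noteq> 0"
      using h[of x] by simp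
    show "G (x - 1) < G x" "G x < G (x + 1)"
      using mono by (simp_all add: strict_mono_def)
    show "G (g y) = y" if "G (x - 1) < y" "y < G (x + 1)" for y
      using that Gg[of "x - 1" y "x + 1"] by simp
    show "isCont g (G x)"
      by (rule isCont_inverse_function[of 1]) (auto simp: gG cont)
  qed
  with that mono gG Gg show thesis by blast
qed

text \<open>Separating variables turns the equation into \<open>G (w t) = \<tau> t\<close> with
  \<open>G' = h\<close> and \<open>\<tau>' = K * exp (\<beta> * t)\<close>. Since \<open>h\<close>
  is integrable at infinity, \<open>G\<close> has a finite supremum \<open>S\<close>, which
  \<open>\<tau>\<close> reaches at a finite time; there \<open>w\<close> must diverge.\<close>

lemma separable_blow_up:
  fixes \<alpha> \<beta> K u0 :: real
  assumes "\<alpha> > 0" "\<beta> > 0" "K > 0"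
  obtains T w where "T > 0" "w 0 = u0"
    "\<And>t. t \<in> {0..<T} \<Longrightarrow>
      (w has_real_derivative K * exp (\<beta> * t + \<alpha> / 2 * (w t)\<^sup>2 - \<beta> * w t)) (at t)"
    "filterlim w at_top (at_left T)"
proof -
  define h where "h = (\<lambda>v::real. exp (\<beta> * v - \<alpha> / 2 * v\<^sup>2))"
  have "\<exists>G. \<forall>x::real. -\<infinity> < ereal x \<longrightarrow> ereal x < \<infinity> \<longrightarrow> (G has_vector_derivative h x) (at x)"
    by (rule einterval_antiderivative) (auto simp: h_def intro!: continuous_intros)
  then obtain G where G: "(G has_real_derivative h x) (at x)" for x
    by (auto simp: has_real_derivative_iff_has_vector_derivative)
  have h_pos: "h x > 0" for x
    by (simp add: h_def)
  obtain g where mono: "strict_mono G" and gG: "\<And>x. g (G x) = x"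
    and g: "\<And>x. (g has_real_derivative inverse (h x)) (at (G x))"
    and Gg: "\<And>a b y. G a \<le> y \<Longrightarrow> y \<le> G b \<Longrightarrow> G (g y) = y"
    using strict_mono_antiderivative_inverse[OF G h_pos] by metis
  \<comment> \<open>Completing the square: \<open>c\<close> is the maximum over \<open>v\<close> of
    \<open>(\<beta> + 1) * v - \<alpha> / 2 * v\<^sup>2\<close>.\<close>
  define c where "c = (\<beta> + 1)\<^sup>2 / (2 * \<alpha>)"
  have h_le: "h v \<le> exp (c - v)" for v
  proof -
    have "c - v - (\<beta> * v - \<alpha> / 2 * v\<^sup>2) = (\<alpha> * v - (\<beta> + 1))\<^sup>2 / (2 * \<alpha>)"
      using \<open>\<alpha> > 0\<close> by (simp add: c_def field_simps power2_eq_square)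
    also have "\<dots> \<ge> 0"
      using \<open>\<alpha> > 0\<close> by simp
    finally show ?thesis
      by (simp add: h_def)
  qed
  have G_le: "G v \<le> G 0 + exp c" for v
  proof (cases "v \<ge> 0")
    case True
    \<comment> \<open>The bound on \<open>h\<close> is integrated by monotonicity:
      \<open>- exp (c - v)\<close> is an antiderivative of the majorant.\<close>
    have "G v + exp (c - v) \<le> G 0 + exp (c - 0)"
    proof (rule DERIV_nonpos_imp_nonincreasing[OF True, of "\<lambda>v. G v + exp (c - v)"])
      fix x
      have "((\<lambda>v. G v + exp (c - v)) has_real_derivative h x - exp (c - x)) (at x)"
        by (auto intro!: derivative_eq_intros G)
      with h_le[of x] show "\<exists>y. ((\<lambda>v. G v + exp (c - v)) has_real_derivative y) (at x) \<and> y \<le> 0"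
        by (intro exI[of _ "h x - exp (c - x)"]) simp
    qed
    then show ?thesis
      using exp_gt_zero[of "c - v"] unfolding diff_zero by linarith
  next
    case False
    then have "G v \<le> G 0"
      using mono by (simp add: strict_mono_less_eq)
    then show ?thesis
      using exp_gt_zero[of c] by linarith
  qed
  define S where "S = (SUP v. G v)"
  have bdd: "bdd_above (range G)"
    using G_le by (intro bdd_aboveI) auto
  have G_less: "G v < S" for v
  proof -
    have "G v < G (v + 1)"
      using mono by (simp add: strict_mono_def)
    also have "\<dots> \<le> S"
      unfolding S_def using bdd by (intro cSUP_upper) auto
    finally show ?thesis .
  qed
  have below_S: "\<exists>v. y < G v" if "y < S" for y
    using that bdd unfolding S_def by (subst (asm) less_cSUP_iff) auto
  \<comment> \<open>\<open>\<tau>\<close> starts at \<open>G u0\<close>, so that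
    \<open>w 0 = u0\<close>; \<open>T\<close> is the solution of
    \<open>\<tau> T = S\<close>.\<close>
  define \<tau> where "\<tau> = (\<lambda>t. G u0 + K * (exp (\<beta> * t) - 1) / \<beta>)"
  define T where "T = ln (1 + \<beta> * (S - G u0) / K) / \<beta>"
  have pos: "\<beta> * (S - G u0) / K > 0"
    using assms G_less[of u0] by simp
  have "T > 0"
    using assms pos unfolding T_def by (intro divide_pos_pos ln_gt_zero) simp_all
  have \<tau>_T: "\<tau> T = S"
    using assms pos by (simp add: \<tau>_def T_def)
  have \<tau>': "(\<tau> has_real_derivative K * exp (\<beta> * t)) (at t)" for t
    unfolding \<tau>_def using assms by (auto intro!: derivative_eq_intros)
  have \<tau>_less: "\<tau> t < S" if "t < T" for t
    using that assms unfolding \<tau>_T[symmetric] by (simp add: \<tau>_def field_simps)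
  have \<tau>_ge: "G u0 \<le> \<tau> t" if "t \<ge> 0" for t
    using that assms by (simp add: \<tau>_def)
  \<comment> \<open>Before time \<open>T\<close>, \<open>\<tau> t\<close> lies between
    \<open>G u0\<close> and some value of \<open>G\<close>, as the right inverse requires.\<close>
  have Gg_\<tau>: "G (g (\<tau> t)) = \<tau> t" if "t \<in> {0..<T}" for t
    using below_S[OF \<tau>_less] \<tau>_ge Gg that by (metis atLeastLessThan_iff less_imp_le)
  show thesis
  proof (rule that[of T "\<lambda>t. g (\<tau> t)"])
    show "T > 0" by fact
    show "g (\<tau> 0) = u0"
      by (simp add: \<tau>_def gG)
    show "((\<lambda>t. g (\<tau> t)) has_real_derivative
        K * exp (\<beta> * t + \<alpha> / 2 * (g (\<tau> t))\<^sup>2 - \<beta> * g (\<tau> t))) (at t)" if t: "t \<in> {0..<T}" for t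
    proof -
      have "(g has_real_derivative inverse (h (g (\<tau> t)))) (at (\<tau> t))"
        using g[of "g (\<tau> t)"] Gg_\<tau>[OF t] by simp
      from DERIV_chain2[OF this \<tau>']
      have "((\<lambda>t. g (\<tau> t)) has_real_derivative inverse (h (g (\<tau> t))) * (K * exp (\<beta> * t))) (at t)" .
      also have "inverse (h (g (\<tau> t))) * (K * exp (\<beta> * t)) =
          K * exp (\<beta> * t + \<alpha> / 2 * (g (\<tau> t))\<^sup>2 - \<beta> * g (\<tau> t))"
        by (simp add: h_def exp_minus[symmetric] exp_add[symmetric] algebra_simps)
      finally show ?thesis .
    qed
    have lim: "(\<tau> \<longlongrightarrow> S) (at_left T)"
      using DERIV_isCont[OF \<tau>'[of T]] unfolding \<tau>_T[symmetric] isCont_def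
      by (rule tendsto_within_subset) simp
    show "filterlim (\<lambda>t. g (\<tau> t)) at_top (at_left T)"
      unfolding filterlim_at_top
    proof
      fix Z
      have "\<forall>\<^sub>F t in at_left T. G Z < \<tau> t"
        using lim G_less by (rule order_tendstoD)
      moreover have "\<forall>\<^sub>F t in at_left T. t \<in> {0<..<T}"
        using \<open>T > 0\<close> by (rule eventually_at_left_real)
      ultimately show "\<forall>\<^sub>F t in at_left T. Z \<le> g (\<tau> t)"
      proof eventually_elim
        case (elim t)
        then have "G Z < G (g (\<tau> t))"
          using Gg_\<tau>[of t] by simp
        then show ?case
          using mono by (simp add: strict_mono_less)
      qed
    qed
  qed
qed

section \<open>Asymptotic rates at the blow-up time\<close>

text \<open>Along the solution \<open>h t * deriv w t = K * exp (\<beta> * t)\<close>. Dividing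
  \<open>h\<close> by \<open>w\<close> cancels the growing factor in \<open>h'\<close>, so that
  \<open>h / w\<close> has a derivative with a finite nonzero limit. The logarithm of the resulting
  estimate gives the rate of \<open>w\<close>; inserting it into the equation gives the rate of
  \<open>deriv w\<close>.\<close>

lemma separable_blow_up_rates:
  fixes \<alpha> \<beta> K T :: real and w :: "real \<Rightarrow> real"
  assumes "\<alpha> > 0" "K > 0" "T > 0"
    and w': "\<And>t. t \<in> {0<..<T} \<Longrightarrow>
      (w has_real_derivative K * exp (\<beta> * t + \<alpha> / 2 * (w t)\<^sup>2 - \<beta> * w t)) (at t)"
    and w_top: "filterlim w at_top (at_left T)"
  shows "w \<sim>[at_left T] (\<lambda>t. sqrt (2 / \<alpha>) * ln (1 / (T - t)) powr (1 / 2))"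
    and "deriv w \<sim>[at_left T]
      (\<lambda>t. 1 / sqrt (2 * \<alpha>) * (T - t) powr (- 1) * ln (1 / (T - t)) powr (- 1 / 2))"
proof -
  define h where "h = (\<lambda>t. exp (\<beta> * w t - \<alpha> / 2 * (w t)\<^sup>2))"
  define c where "c = \<alpha> * K * exp (\<beta> * T)"
  have "c > 0"
    using assms by (simp add: c_def)
  have ev_I: "\<forall>\<^sub>F t in at_left T. t \<in> {0<..<T}"
    using \<open>T > 0\<close> by (rule eventually_at_left_real)
  have ev_w: "\<forall>\<^sub>F t in at_left T. w t > 0"
    using w_top by (auto simp: filterlim_at_top_dense)
  have inv_w: "((\<lambda>t. 1 / w t) \<longlongrightarrow> 0) (at_left T)"
    using w_top by (intro tendsto_divide_0[OF tendsto_const] filterlim_at_top_imp_at_infinity)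
  have exp_T: "((\<lambda>t. exp (\<beta> * t)) \<longlongrightarrow> exp (\<beta> * T)) (at_left T)"
    by (intro tendsto_intros)

  have ratio: "((\<lambda>t. h t / w t / (T - t)) \<longlongrightarrow> c) (at_left T)"
  proof (rule lhopital_left[where g' = "\<lambda>t. - 1"
        and f' = "\<lambda>t. K * exp (\<beta> * t) * (\<beta> * (1 / w t) - \<alpha> - (1 / w t)\<^sup>2)"])
    have "((\<lambda>x::real. exp (\<beta> * x - \<alpha> / 2 * x\<^sup>2) / x) \<longlongrightarrow> 0) at_top"
      using \<open>\<alpha> > 0\<close> by real_asymp
    then show "((\<lambda>t. h t / w t) \<longlongrightarrow> 0) (at_left T)"
      unfolding h_def by (rule filterlim_compose[OF _ w_top])
    show "((\<lambda>t. T - t) \<longlongrightarrow> 0) (at_left T)"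
      by (auto intro!: tendsto_eq_intros)
    show "\<forall>\<^sub>F t in at_left T. T - t \<noteq> 0"
      using ev_I by eventually_elim simp
    show "\<forall>\<^sub>F t in at_left T. (- 1 :: real) \<noteq> 0"
      by simp
    show "\<forall>\<^sub>F t in at_left T. ((\<lambda>t. T - t) has_real_derivative - 1) (at t)"
      by (auto intro!: always_eventually derivative_eq_intros)
    show "\<forall>\<^sub>F t in at_left T. ((\<lambda>t. h t / w t) has_real_derivative
        K * exp (\<beta> * t) * (\<beta> * (1 / w t) - \<alpha> - (1 / w t)\<^sup>2)) (at t)"
      using ev_I ev_w
    proof eventually_elim
      case (elim t)
      define w1 where "w1 = K * exp (\<beta> * t + \<alpha> / 2 * (w t)\<^sup>2 - \<beta> * w t)"
      have w1: "(w has_real_derivative w1) (at t)"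
        unfolding w1_def using w' elim by blast
      have hw1: "h t * w1 = K * exp (\<beta> * t)"
        by (simp add: h_def w1_def exp_add[symmetric] mult.left_commute)
      have "((\<lambda>t. h t / w t) has_real_derivative
          (h t * (\<beta> * w1 - \<alpha> * w t * w1) * w t - h t * w1) / (w t * w t)) (at t)"
        unfolding h_def using elim by (auto intro!: derivative_eq_intros w1 simp: field_simps)
      also have "(h t * (\<beta> * w1 - \<alpha> * w t * w1) * w t - h t * w1) / (w t * w t) =
          (h t * w1) * (\<beta> * (1 / w t) - \<alpha> - (1 / w t)\<^sup>2)"
        using elim by (simp add: field_simps power2_eq_square)
      finally show ?case
        unfolding hw1 .
    qed
    show "((\<lambda>t. K * exp (\<beta> * t) * (\<beta> * (1 / w t) - \<alpha> - (1 / w t)\<^sup>2) / - 1) \<longlongrightarrow> c) (at_left T)"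
      by (rule tendsto_eq_intros exp_T inv_w refl)+ (simp_all add: c_def)
  qed

  define L where "L = (\<lambda>t. ln (1 / (T - t)))"
  have L_top: "filterlim L at_top (at_left T)"
    unfolding L_def by real_asymp
  have ev_L: "\<forall>\<^sub>F t in at_left T. L t > 0"
    using L_top by (auto simp: filterlim_at_top_dense)

  \<comment> \<open>Expanding the logarithm of the ratio and dividing by the square of
    \<open>w\<close> isolates \<open>L t / (w t)\<^sup>2\<close>. Only the quadratic term of the
    exponent survives in the limit.\<close>
  have "((\<lambda>t. ln (h t / w t / (T - t)) * (1 / w t)\<^sup>2) \<longlongrightarrow> ln c * 0\<^sup>2) (at_left T)"
    using \<open>c > 0\<close> by (intro tendsto_mult tendsto_power tendsto_ln ratio inv_w) simp
  moreover have "((\<lambda>t. \<beta> / w t - \<alpha> / 2 - ln (w t) / (w t)\<^sup>2) \<longlongrightarrow> - \<alpha> / 2) (at_left T)"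
  proof -
    have "((\<lambda>x::real. \<beta> / x - \<alpha> / 2 - ln x / x\<^sup>2) \<longlongrightarrow> - \<alpha> / 2) at_top"
      by real_asymp
    then show ?thesis
      by (rule filterlim_compose[OF _ w_top])
  qed
  ultimately have "((\<lambda>t. ln (h t / w t / (T - t)) * (1 / w t)\<^sup>2 -
      (\<beta> / w t - \<alpha> / 2 - ln (w t) / (w t)\<^sup>2)) \<longlongrightarrow> ln c * 0\<^sup>2 - (- \<alpha> / 2)) (at_left T)"
    by (rule tendsto_diff)
  then have L_w: "((\<lambda>t. L t / (w t)\<^sup>2) \<longlongrightarrow> \<alpha> / 2) (at_left T)"
  proof (rule Lim_transform_eventually[THEN tendsto_eq_rhs])
    show "\<forall>\<^sub>F t in at_left T. ln (h t / w t / (T - t)) * (1 / w t)\<^sup>2 -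
        (\<beta> / w t - \<alpha> / 2 - ln (w t) / (w t)\<^sup>2) = L t / (w t)\<^sup>2"
      using ev_I ev_w
    proof eventually_elim
      case (elim t)
      then have ln_ratio: "ln (h t / w t / (T - t)) = \<beta> * w t - \<alpha> / 2 * (w t)\<^sup>2 - ln (w t) + L t"
        by (simp add: h_def L_def ln_div ln_mult)
      show ?case
        unfolding ln_ratio using elim by (simp add: field_simps power2_eq_square)
    qed
  qed simp
  have w_L: "((\<lambda>t. w t / L t powr (1 / 2)) \<longlongrightarrow> sqrt (2 / \<alpha>)) (at_left T)"
  proof (rule Lim_transform_eventually[THEN tendsto_eq_rhs])
    show "((\<lambda>t. 1 / sqrt (L t / (w t)\<^sup>2)) \<longlongrightarrow> 1 / sqrt (\<alpha> / 2)) (at_left T)"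
      using \<open>\<alpha> > 0\<close> by (intro tendsto_intros L_w) simp
    show "\<forall>\<^sub>F t in at_left T. 1 / sqrt (L t / (w t)\<^sup>2) = w t / L t powr (1 / 2)"
      using ev_w ev_L by eventually_elim (simp add: real_sqrt_divide powr_half_sqrt)
  qed (simp add: real_sqrt_divide)
  then have "w \<sim>[at_left T] (\<lambda>t. sqrt (2 / \<alpha>) * L t powr (1 / 2))"
    using \<open>\<alpha> > 0\<close> by (intro asymp_equivI'_const) auto
  then show "w \<sim>[at_left T] (\<lambda>t. sqrt (2 / \<alpha>) * ln (1 / (T - t)) powr (1 / 2))"
    by (simp add: L_def)

  have "((\<lambda>t. deriv w t / ((T - t) powr (- 1) * L t powr (- 1 / 2))) \<longlongrightarrow> 1 / sqrt (2 * \<alpha>))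
      (at_left T)"
  proof (rule Lim_transform_eventually[THEN tendsto_eq_rhs])
    \<comment> \<open>The factors \<open>w t\<close> cancel, leaving
      \<open>deriv w t * (T - t) * L t powr (1 / 2)\<close>, while each quotient has a known
      limit.\<close>
    show "((\<lambda>t. K * exp (\<beta> * t) / (h t / w t / (T - t)) / (w t / L t powr (1 / 2))) \<longlongrightarrow>
        K * exp (\<beta> * T) / c / sqrt (2 / \<alpha>)) (at_left T)"
      using \<open>c > 0\<close> \<open>\<alpha> > 0\<close> by (intro tendsto_intros exp_T ratio w_L) auto
    show "\<forall>\<^sub>F t in at_left T. K * exp (\<beta> * t) / (h t / w t / (T - t)) / (w t / L t powr (1 / 2)) =
        deriv w t / ((T - t) powr (- 1) * L t powr (- 1 / 2))"
      using ev_I ev_w ev_L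
    proof eventually_elim
      case (elim t)
      have "deriv w t = K * exp (\<beta> * t + \<alpha> / 2 * (w t)\<^sup>2 - \<beta> * w t)"
        using w'[of t] elim by (simp add: DERIV_imp_deriv)
      also have "\<dots> = K * exp (\<beta> * t) / h t"
        by (simp add: h_def exp_diff exp_add)
      finally have deriv_w: "deriv w t = K * exp (\<beta> * t) / h t" .
      have "h t \<noteq> 0"
        by (simp add: h_def)
      then show ?case
        unfolding deriv_w using elim by (simp add: powr_minus divide_simps)
    qed
    show "K * exp (\<beta> * T) / c / sqrt (2 / \<alpha>) = 1 / sqrt (2 * \<alpha>)"
      using assms by (simp add: c_def real_sqrt_divide real_sqrt_mult field_simps)
  qed
  then have "deriv w \<sim>[at_left T]
      (\<lambda>t. 1 / sqrt (2 * \<alpha>) * ((T - t) powr (- 1) * L t powr (- 1 / 2)))"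
    using \<open>\<alpha> > 0\<close> by (intro asymp_equivI'_const) auto
  then show "deriv w \<sim>[at_left T]
      (\<lambda>t. 1 / sqrt (2 * \<alpha>) * (T - t) powr (- 1) * ln (1 / (T - t)) powr (- 1 / 2))"
    by (simp add: L_def mult.assoc)
qed

section \<open>Evaluating the delay integral\<close>

lemma set_integrable_exp_atMost:
  fixes \<beta> b :: real
  assumes "\<beta> > 0"
  shows "set_integrable lborel {..b} (\<lambda>s. exp (\<beta> * s))"
proof (rule set_integrable_subset)
  have bot: "((\<lambda>s. exp (\<beta> * s) / \<beta>) \<longlongrightarrow> 0) at_bot"
    using assms by real_asymp
  \<comment> \<open>\<open>einterval\<close> is open, so the end point \<open>b + 1\<close> is taken
    to include \<open>b\<close>.\<close>
  show "set_integrable lborel (einterval (-\<infinity>) (ereal (b + 1))) (\<lambda>s. exp (\<beta> * s))"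
  proof (rule interval_integral_FTC_nonneg(1)[where F = "\<lambda>s. exp (\<beta> * s) / \<beta>"])
    show "(((\<lambda>s. exp (\<beta> * s) / \<beta>) \<circ> real_of_ereal) \<longlongrightarrow> 0) (at_right (-\<infinity>))"
      using bot by (simp add: ereal_tendsto_simps1)
    show "(((\<lambda>s. exp (\<beta> * s) / \<beta>) \<circ> real_of_ereal) \<longlongrightarrow> exp (\<beta> * (b + 1)) / \<beta>)
        (at_left (ereal (b + 1)))"
      using assms by (auto simp: ereal_tendsto_simps1 intro!: tendsto_intros)
  qed (use assms in \<open>auto intro!: derivative_eq_intros continuous_intros\<close>)
qed (auto simp: einterval_def)

text \<open>Identifies the delay term from the linear equation
  \<open>I' = \<alpha> * u - \<beta> * I\<close> and its value at 0. With the integrating factor,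
  \<open>exp (\<beta> * s) * I s\<close> is an antiderivative of \<open>f\<close> on
  \<open>{0..t}\<close>, and the history contributes exactly \<open>I 0\<close>.\<close>

lemma delay_term_eqI:
  fixes \<alpha> \<beta> t :: real and \<phi> u I :: "real \<Rightarrow> real"
  assumes \<phi>: "continuous_on {..0} \<phi>" "bounded (\<phi> ` {..0})"
    and "\<beta> > 0" "t \<ge> 0"
    and u: "\<And>s. s \<le> 0 \<Longrightarrow> u s = \<phi> s" "continuous_on {0..t} u"
    and I: "I 0 = delay_term \<alpha> \<beta> \<phi> 0"
      "\<And>s. s \<in> {0..t} \<Longrightarrow> (I has_real_derivative \<alpha> * u s - \<beta> * I s) (at s within {0..t})"
  shows "set_integrable lborel {..t} (\<lambda>s. \<alpha> * exp (- \<beta> * (t - s)) * u s)"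
    and "delay_term \<alpha> \<beta> u t = I t"
proof -
  \<comment> \<open>The kernel factors, so the integrand can be freed of the upper limit
    \<open>t\<close>.\<close>
  define f where "f = (\<lambda>s. \<alpha> * exp (\<beta> * s) * u s)"
  have f_eq: "\<alpha> * exp (- \<beta> * (r - s)) * u s = exp (- \<beta> * r) * f s" for r s
    by (simp add: f_def exp_add[symmetric] exp_diff exp_minus field_simps)
  have "set_integrable lborel {..0} (\<lambda>s. \<alpha> * exp (\<beta> * s) * \<phi> s)"
  proof -
    obtain M where M: "\<bar>\<phi> s\<bar> \<le> M" if "s \<le> 0" for s
      using \<phi>(2) unfolding bounded_iff by auto
    show ?thesis
    \<comment> \<open>The bounded history is dominated by a multiple of the decaying
      exponential.\<close>
    proof (rule set_integrable_bound)
      show "set_integrable lborel {..0} (\<lambda>s. \<bar>\<alpha>\<bar> * M * exp (\<beta> * s))"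
        using set_integrable_exp_atMost[OF \<open>\<beta> > 0\<close>] by (rule set_integrable_mult_right)
      have "continuous_on {..0} (\<lambda>s. \<alpha> * exp (\<beta> * s) * \<phi> s)"
        by (intro continuous_intros \<phi>(1))
      then show "set_borel_measurable lborel {..0} (\<lambda>s. \<alpha> * exp (\<beta> * s) * \<phi> s)"
        unfolding set_borel_measurable_def measurable_lborel2
        by (intro borel_measurable_continuous_on_indicator) auto
      have "norm (\<alpha> * exp (\<beta> * s) * \<phi> s) \<le> norm (\<bar>\<alpha>\<bar> * M * exp (\<beta> * s))" if "s \<le> 0" for s
        using mult_left_mono[OF order_trans[OF M[OF that] abs_ge_self],
            of "\<bar>\<alpha>\<bar> * exp (\<beta> * s)"]
        by (simp add: abs_mult mult_ac)
      then show "AE s in lborel. s \<in> {..0} \<longrightarrow>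
          norm (\<alpha> * exp (\<beta> * s) * \<phi> s) \<le> norm (\<bar>\<alpha>\<bar> * M * exp (\<beta> * s))"
        by simp
    qed
  qed
  then have f_past: "set_integrable lborel {..0} f"
    by (rule set_integrable_cong[THEN iffD1, rotated -1]) (auto simp: f_def u(1))
  have f_cont: "continuous_on {0..t} f"
    unfolding f_def by (intro continuous_intros u(2))
  have f_Icc: "set_integrable lborel {0..t} f"
    using f_cont by (rule borel_integrable_atLeastAtMost')
  have f_pres: "set_integrable lborel {0<..t} f"
    using f_Icc by (rule set_integrable_subset) auto
  have split: "{..t} = {..0} \<union> {0<..t}"
    using \<open>t \<ge> 0\<close> by auto
  have "set_integrable lborel {..t} f"
    unfolding split by (intro set_integrable_Un f_past f_pres) auto
  then show "set_integrable lborel {..t} (\<lambda>s. \<alpha> * exp (- \<beta> * (t - s)) * u s)"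
    unfolding f_eq by simp
  have past: "(LBINT s:{..0}. f s) = I 0"
    unfolding I(1) delay_term_def by (intro set_lebesgue_integral_cong) (auto simp: f_def u(1))
  \<comment> \<open>The disjoint splitting uses \<open>{0<..t}\<close> and the fundamental theorem
    uses \<open>{0..t}\<close>; they differ by a null set.\<close>
  have "(LBINT s:{0<..t}. f s) = (LBINT s:{0..t}. f s)"
  proof -
    have Icc: "{0..t} = {0} \<union> {0<..t}"
      using \<open>t \<ge> 0\<close> by auto
    have "(LBINT s:{0..t}. f s) = (LBINT s:{0}. f s) + (LBINT s:{0<..t}. f s)"
      unfolding Icc using \<open>t \<ge> 0\<close>
      by (intro set_integral_Un f_pres set_integrable_subset[OF f_Icc]) auto
    also have "(LBINT s:{0}. f s) = 0"
      unfolding set_lebesgue_integral_def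
      by (rule integral_eq_zero_AE, rule eventually_mono[OF AE_lborel_singleton[of 0]]) simp
    finally show ?thesis by simp
  qed
  also have "\<dots> = exp (\<beta> * t) * I t - exp (\<beta> * 0) * I 0"
    unfolding set_lebesgue_integral_def
  proof (rule integral_FTC_atLeastAtMost[where F = "\<lambda>s. exp (\<beta> * s) * I s"])
    fix s assume "0 \<le> s" "s \<le> t"
    then have "((\<lambda>s. exp (\<beta> * s) * I s) has_real_derivative f s) (at s within {0..t})"
      by (auto intro!: derivative_eq_intros I(2) simp: f_def algebra_simps)
    then show "((\<lambda>s. exp (\<beta> * s) * I s) has_vector_derivative f s) (at s within {0..t})"
      by (simp add: has_real_derivative_iff_has_vector_derivative)
  qed (use \<open>t \<ge> 0\<close> f_cont in auto)
  finally have "(LBINT s:{..t}. f s) = exp (\<beta> * t) * I t"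
    unfolding split by (subst set_integral_Un[OF _ f_past f_pres]) (auto simp: past)
  then show "delay_term \<alpha> \<beta> u t = I t"
    unfolding delay_term_def f_eq by (simp add: exp_minus)
qed

section \<open>Back to the delay equation\<close>

text \<open>The assumption \<open>delay_term \<alpha> \<beta> \<phi> 0 < 1\<close> makes the
  denominator positive at time 0, hence \<open>K > 0\<close>. The separable solution, glued to the
  history, then solves the delay equation because \<open>1 - y\<close> satisfies the linear equation
  that characterises the delay term.\<close>

theorem theorem2:
  fixes \<alpha> \<beta> :: real and \<phi> :: "real \<Rightarrow> real"
  assumes "continuous_on {..0} \<phi>"
    and "bounded (\<phi> ` {..0})"
    and "\<And>s. s \<le> 0 \<Longrightarrow> \<phi> s > 0"
    and "\<alpha> > 0" and "\<beta> > 0"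
    and "delay_term \<alpha> \<beta> \<phi> 0 < 1"
  shows "\<exists>T>0. \<exists>u. is_solution \<alpha> \<beta> \<phi> T u \<and> blows_up_at u T \<and>
           (\<exists>A\<^sub>3>0. \<exists>A\<^sub>4>0.
              u \<sim>[at_left T] (\<lambda>t. A\<^sub>3 * ln (1 / (T - t)) powr (1 / 2)) \<and>
              deriv u \<sim>[at_left T]
                (\<lambda>t. A\<^sub>4 * (T - t) powr (- 1) * ln (1 / (T - t)) powr (- 1 / 2)))"
proof -
  define y0 where "y0 = 1 - delay_term \<alpha> \<beta> \<phi> 0"
  \<comment> \<open>The first integral at time 0 dictates this value: it gives
    \<open>y 0 = y0\<close>.\<close>
  define K where "K = exp (\<beta> * \<phi> 0 - \<alpha> / 2 * (\<phi> 0)\<^sup>2) / y0"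
  have "y0 > 0"
    using assms(6) by (simp add: y0_def)
  then have "K > 0"
    by (simp add: K_def)
  obtain T w where "T > 0" and w0: "w 0 = \<phi> 0"
    and w': "\<And>t. t \<in> {0..<T} \<Longrightarrow>
      (w has_real_derivative K * exp (\<beta> * t + \<alpha> / 2 * (w t)\<^sup>2 - \<beta> * w t)) (at t)"
    and w_top: "filterlim w at_top (at_left T)"
    using separable_blow_up[OF assms(4,5) \<open>K > 0\<close>, of "\<phi> 0"] by metis
  have w'_open: "(w has_real_derivative K * exp (\<beta> * t + \<alpha> / 2 * (w t)\<^sup>2 - \<beta> * w t)) (at t)"
    if "t \<in> {0<..<T}" for t
    using w' that by simp
  define u where "u = (\<lambda>t. if t \<le> 0 then \<phi> t else w t)"
  \<comment> \<open>The first integral solved for the denominator; the separable equation becomes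
    \<open>w' = 1 / y\<close>.\<close>
  define y where "y = (\<lambda>t. exp (\<beta> * w t - \<alpha> / 2 * (w t)\<^sup>2 - \<beta> * t) / K)"
  have u_past: "u t = \<phi> t" if "t \<le> 0" for t
    using that by (simp add: u_def)
  have u_w: "u t = w t" if "t \<ge> 0" for t
    using that w0 by (simp add: u_def)
  have y_inverse: "K * exp (\<beta> * t + \<alpha> / 2 * (w t)\<^sup>2 - \<beta> * w t) = 1 / y t" for t
    by (simp add: y_def exp_diff exp_add)
  have w'_y: "(w has_real_derivative 1 / y t) (at t)" if "t \<in> {0..<T}" for t
    using w'[OF that] unfolding y_inverse .
  have y_pos: "y t > 0" for t
    using \<open>K > 0\<close> by (simp add: y_def)
  have y': "(y has_real_derivative \<beta> * (1 - y t) - \<alpha> * w t) (at t)" if "t \<in> {0..<T}" for t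
  proof -
    have "(y has_real_derivative y t * (\<beta> * (1 / y t) - \<alpha> * w t * (1 / y t) - \<beta>)) (at t)"
      unfolding y_def using \<open>K > 0\<close>
      by (auto intro!: derivative_eq_intros w'_y[OF that, unfolded y_def] simp: field_simps)
    also have "y t * (\<beta> * (1 / y t) - \<alpha> * w t * (1 / y t) - \<beta>) = \<beta> * (1 - y t) - \<alpha> * w t"
      using y_pos[of t] by (simp add: field_simps)
    finally show ?thesis .
  qed
  have delay: "set_integrable lborel {..t} (\<lambda>s. \<alpha> * exp (- \<beta> * (t - s)) * u s)"
      "delay_term \<alpha> \<beta> u t = 1 - y t" if t: "t \<in> {0..<T}" for t
  proof -
    have "continuous_on {0..t} w"
      using t by (intro continuous_at_imp_continuous_on ballI DERIV_isCont[OF w']) auto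
    then have u_cont: "continuous_on {0..t} u"
      by (rule continuous_on_eq) (simp add: u_w)
    have y0: "1 - y 0 = delay_term \<alpha> \<beta> \<phi> 0"
      using \<open>y0 > 0\<close> by (simp add: y_def K_def w0 y0_def)
    have "((\<lambda>s. 1 - y s) has_real_derivative \<alpha> * u s - \<beta> * (1 - y s)) (at s within {0..t})"
      if "s \<in> {0..t}" for s
      using that t by (auto intro!: derivative_eq_intros has_field_derivative_at_within[OF y'] simp: u_w)
    from delay_term_eqI[OF assms(1,2,5) _ u_past u_cont y0 this] t
    show "set_integrable lborel {..t} (\<lambda>s. \<alpha> * exp (- \<beta> * (t - s)) * u s)"
      "delay_term \<alpha> \<beta> u t = 1 - y t"
      by auto
  qed
  have sol: "is_solution \<alpha> \<beta> \<phi> T u"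
    unfolding is_solution_def
  proof (intro conjI ballI allI impI)
    fix t assume t: "t \<in> {0..<T}"
    show "set_integrable lborel {..t} (\<lambda>s. \<alpha> * exp (- \<beta> * (t - s)) * u s)"
      by (rule delay(1)[OF t])
    show "1 - delay_term \<alpha> \<beta> u t \<noteq> 0"
      using y_pos[of t] by (simp add: delay(2)[OF t])
    \<comment> \<open>At \<open>t = 0\<close> this is one-sided: \<open>u\<close> agrees with
      \<open>w\<close> on \<open>{0..<T}\<close>, but possibly not to the left of 0.\<close>
    have "(u has_real_derivative 1 / y t) (at t within {0..<T})"
      by (rule has_field_derivative_transform_within[OF has_field_derivative_at_within[OF w'_y[OF t]]
            zero_less_one t]) (simp add: u_w)
    then show "(u has_real_derivative 1 / (1 - delay_term \<alpha> \<beta> u t)) (at t within {0..<T})"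
      by (simp add: delay(2)[OF t])
  qed (rule u_past)
  have ev_I: "\<forall>\<^sub>F t in at_left T. t \<in> {0<..<T}"
    using \<open>T > 0\<close> by (rule eventually_at_left_real)
  have ev_u: "\<forall>\<^sub>F t in at_left T. w t = u t"
    using ev_I by eventually_elim (simp add: u_w)
  \<comment> \<open>\<open>deriv\<close> is two-sided, so agreement on a whole neighbourhood of
    \<open>t > 0\<close> is used.\<close>
  have ev_deriv: "\<forall>\<^sub>F t in at_left T. deriv w t = deriv u t"
    using ev_I
  proof eventually_elim
    case (elim t)
    have "\<forall>\<^sub>F s in nhds t. s \<in> {0<..<T}"
      using elim by (intro eventually_nhds_in_open) auto
    then have "\<forall>\<^sub>F s in nhds t. w s = u s"
      by eventually_elim (simp add: u_w)
    then show ?case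
      by (rule deriv_cong_ev) simp
  qed
  have "blows_up_at u T"
    unfolding blows_up_at_def using w_top by (rule filterlim_cong[OF refl refl ev_u, THEN iffD1])
  moreover have "u \<sim>[at_left T] (\<lambda>t. sqrt (2 / \<alpha>) * ln (1 / (T - t)) powr (1 / 2))"
    using asymp_equiv_refl_ev[OF ev_u]
      separable_blow_up_rates(1)[OF assms(4) \<open>K > 0\<close> \<open>T > 0\<close> w'_open w_top]
    by (rule asymp_equiv_trans[OF asymp_equiv_symI])
  moreover have "deriv u \<sim>[at_left T]
      (\<lambda>t. 1 / sqrt (2 * \<alpha>) * (T - t) powr (- 1) * ln (1 / (T - t)) powr (- 1 / 2))"
    using asymp_equiv_refl_ev[OF ev_deriv]
      separable_blow_up_rates(2)[OF assms(4) \<open>K > 0\<close> \<open>T > 0\<close> w'_open w_top]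
    by (rule asymp_equiv_trans[OF asymp_equiv_symI])
  moreover have "sqrt (2 / \<alpha>) > 0" "1 / sqrt (2 * \<alpha>) > 0"
    using assms(4) by simp_all
  ultimately show ?thesis
    using sol \<open>T > 0\<close> by blast
qed

end
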